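(* Let $n\in\mathbb{Z}\setminus\{0\}$, $a\in\mathbb{C}\setminus\{0\}$, $\mu\in\mathbb{C}\setminus\{0\}$, $b\in\mathbb{C}$, and let $\delta:\Omega(\mu,b)\to\Omega(\mu,b)$ be a linear map. Then $(\Omega(\mu,b),\delta)$ is a $1$-differential module over $(\mathrm{Vir},d_{n,a})$ if and only if $a\mu^{n-1}=1$ and $\delta$ is defined by $\delta(t^j)=\xi\left(\frac{t}{n}\right)^j-t^j$ (for all integers $j\ge0$) for some $\xi\in\mathbb{C}$.
   Context: All spaces and algebras are over $\mathbb{C}$ and all linear maps are $\mathbb{C}$-linear. For a Lie algebra $\mathcal{L}$, a $1$-differential operator on $\mathcal{L}$ is a linear map $d:\mathcal{L}\to\mathcal{L}$ such that $d[x,y]=[d(x),y]+[x,d(y)]+[d(x),d(y)]$ for all $x,y\in\mathcal{L}$. A $1$-differential module over $(\mathcal{L},d)$ is a pair $(V,\delta)$ where $V$ is an $\mathcal{L}$-module and $\delta:V\to V$ is a linear map with $\delta(xv)=d(x)v+x\delta(v)+d(x)\delta(v)$ for all $x\in\mathcal{L}$, $v\in V$. (The map $\delta=-\mathrm{id}_V$ always satisfies this; it is called the trivial $1$-differential module structure.) The Virasoro algebra $\mathrm{Vir}$ is the complex Lie algebra with basis $\{L_n, C \mid n\in\mathbb{Z}\}$ and brackets $[L_m,L_n]=(n-m)L_{n+m}+\delta_{n,-m}\frac{m^3-m}{12}C$, $[C,L_m]=0$. For $n\in\mathbb{Z}\setminus\{0\}$, $a\in\mathbb{C}\setminus\{0\}$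 the $1$-differential operator $d_{n,a}$ on $\mathrm{Vir}$ is given by $d_{n,a}(L_i)=\frac{a^i}{n}\left(L_{ni}-\delta_{i,0}\frac{n^2-1}{24}C\right)-L_i$ and $d_{n,a}(C)=nC-C$. $\Omega(\mu,b)$ denotes the $\mathrm{Vir}$-module whose underlying space is the polynomial space $\mathbb{C}[t]$, with action $L_i(t^j)=\mu^i(t-ib)(t-i)^j$, $C\,t^j=0$ for $i\in\mathbb{Z}$, $j\in\mathbb{Z}$ with $j\ge0$.
   Formalization: The trivial structure δ = −id is listed as a separate alternative not requiring aμ^{n−1}=1, since it is always a 1-differential module structure and so refutes the literal equivalence (e.g. n=2, a=2, μ=1). *)

theory Defs
  imports
    Complex_Main
    "HOL-Library.Poly_Mapping"
    "HOL-Computational_Algebra.Polynomial"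
begin

section \<open>1-differential Lie algebras and 1-differential modules\<close>

locale lie_algebra = vector_space scale
  for scale :: "complex \<Rightarrow> 'a::ab_group_add \<Rightarrow> 'a" +
  fixes bracket :: "'a \<Rightarrow> 'a \<Rightarrow> 'a"
  assumes bracket_linear_left: "Vector_Spaces.linear scale scale (\<lambda>x. bracket x y)"
    and bracket_linear_right: "Vector_Spaces.linear scale scale (\<lambda>y. bracket x y)"
    and bracket_self: "bracket x x = 0"
    and jacobi: "bracket x (bracket y z) + bracket y (bracket z x) + bracket z (bracket x y) = 0"

locale lie_module = lie_algebra scale bracket
  for scale :: "complex \<Rightarrow> 'a::ab_group_add \<Rightarrow> 'a" and bracket :: "'a \<Rightarrow> 'a \<Rightarrow> 'a" +
  fixes vscale :: "complex \<Rightarrow> 'v::ab_group_add \<Rightarrow> 'v" and act :: "'a \<Rightarrow> 'v \<Rightarrow> 'v"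
  assumes act_linear_left: "Vector_Spaces.linear scale vscale (\<lambda>x. act x v)"
    and act_linear_right: "Vector_Spaces.linear vscale vscale (\<lambda>v. act x v)"
    and act_bracket: "act (bracket x y) v = act x (act y v) - act y (act x v)"

locale one_diff_lie_algebra = lie_algebra scale bracket
  for scale :: "complex \<Rightarrow> 'a::ab_group_add \<Rightarrow> 'a" and bracket :: "'a \<Rightarrow> 'a \<Rightarrow> 'a" +
  fixes d :: "'a \<Rightarrow> 'a"
  assumes d_linear: "Vector_Spaces.linear scale scale d"
    and d_bracket: "d (bracket x y) = bracket (d x) y + bracket x (d y) + bracket (d x) (d y)"

locale one_diff_module =
  one_diff_lie_algebra scale bracket d + lie_module scale bracket vscale act
  for scale :: "complex \<Rightarrow> 'a::ab_group_add \<Rightarrow> 'a" and bracket :: "'a \<Rightarrow> 'a \<Rightarrow> 'a"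
    and d :: "'a \<Rightarrow> 'a"
    and vscale :: "complex \<Rightarrow> 'v::ab_group_add \<Rightarrow> 'v" and act :: "'a \<Rightarrow> 'v \<Rightarrow> 'v" +
  fixes \<delta> :: "'v \<Rightarrow> 'v"
  assumes \<delta>_linear: "Vector_Spaces.linear vscale vscale \<delta>"
    and \<delta>_act: "\<delta> (act x v) = act (d x) v + act x (\<delta> v) + act (d x) (\<delta> v)"

text \<open>
  The trivial structure \<open>\<delta> = -id\<close> exists on every module, without any condition relating
  the module to \<open>d\<close>; classification statements must list it separately.
\<close>

lemma one_diff_module_trivial:
  assumes "one_diff_lie_algebra scale bracket d" and "lie_module scale bracket vscale act"
  shows "one_diff_module scale bracket d vscale act (\<lambda>v. - v)"
proof -
  interpret M: lie_module scale bracket vscale act by fact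
  interpret V: vector_space vscale
    using M.act_linear_right by (simp add: Vector_Spaces.linear_def)
  have neg: "act x (- v) = - act x v" for x v
    using Vector_Spaces.linear.axioms(3)[OF M.act_linear_right[of x], THEN module_hom.neg] .
  have "Vector_Spaces.linear vscale vscale (\<lambda>v. - v)"
    by (simp add: module_hom_iff_linear[symmetric] module_hom_def module_hom_axioms_def
      V.module_axioms V.scale_minus_right)
  then show ?thesis
    using assms by (simp add: one_diff_module_def one_diff_module_axioms_def neg)
qed


section \<open>The Virasoro algebra\<close>

datatype vir_basis = L int | C

text \<open>The vector space with basis \<open>{L n, C | n \<in> \<int>}\<close>: finitely supported coefficient functions.\<close>

type_synonym vir = "vir_basis \<Rightarrow>\<^sub>0 complex"

definition vir_scale :: "complex \<Rightarrow> vir \<Rightarrow> vir" where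
  "vir_scale c x = Poly_Mapping.map ((*) c) x"

text \<open>Linear extension of a map given on basis vectors.\<close>

definition lin_ext :: "(complex \<Rightarrow> 'v \<Rightarrow> 'v) \<Rightarrow> (vir_basis \<Rightarrow> 'v) \<Rightarrow> vir \<Rightarrow> 'v::comm_monoid_add" where
  "lin_ext scale f x = (\<Sum>i\<in>Poly_Mapping.keys x. scale (Poly_Mapping.lookup x i) (f i))"

abbreviation vL :: "int \<Rightarrow> vir" where
  "vL i \<equiv> Poly_Mapping.single (L i) 1"

abbreviation vC :: vir where
  "vC \<equiv> Poly_Mapping.single C 1"

fun vir_bracket_basis :: "vir_basis \<Rightarrow> vir_basis \<Rightarrow> vir" where
  "vir_bracket_basis (L m) (L n) =
     vir_scale (of_int (n - m)) (vL (n + m)) +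
     (if n = - m then vir_scale ((of_int m ^ 3 - of_int m) / 12) vC else 0)"
| "vir_bracket_basis C (L m) = 0"
| "vir_bracket_basis (L m) C = 0"
| "vir_bracket_basis C C = 0"

definition vir_bracket :: "vir \<Rightarrow> vir \<Rightarrow> vir" where
  "vir_bracket x y = lin_ext vir_scale (\<lambda>i. lin_ext vir_scale (vir_bracket_basis i) y) x"

fun vir_d_basis :: "int \<Rightarrow> complex \<Rightarrow> vir_basis \<Rightarrow> vir" where
  "vir_d_basis n a (L i) =
     vir_scale (a powi i / of_int n)
       (vL (n * i) - (if i = 0 then vir_scale ((of_int n ^ 2 - 1) / 24) vC else 0)) - vL i"
| "vir_d_basis n a C = vir_scale (of_int n) vC - vC"

definition vir_d :: "int \<Rightarrow> complex \<Rightarrow> vir \<Rightarrow> vir" where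
  "vir_d n a = lin_ext vir_scale (vir_d_basis n a)"


section \<open>The modules \<open>\<Omega>(\<mu>, b)\<close>\<close>

text \<open>
  The underlying space is the type \<open>complex poly\<close> with scalar multiplication \<open>smult\<close>; the
  variable \<open>t\<close> is \<open>[:0, 1:]\<close>. The linear map \<open>t^j \<mapsto> \<mu>^i (t - i b) (t - i)^j\<close> is written as
  substitution \<open>t \<mapsto> t - i\<close> followed by multiplication; see \<open>omega_act_L\<close> below.
\<close>

fun omega_act_basis :: "complex \<Rightarrow> complex \<Rightarrow> vir_basis \<Rightarrow> complex poly \<Rightarrow> complex poly" where
  "omega_act_basis \<mu> b (L i) f =
     smult (\<mu> powi i) ([:- (of_int i * b), 1:] * pcompose f [:- of_int i, 1:])"
| "omega_act_basis \<mu> b C f = 0"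

definition omega_act :: "complex \<Rightarrow> complex \<Rightarrow> vir \<Rightarrow> complex poly \<Rightarrow> complex poly" where
  "omega_act \<mu> b x f = lin_ext smult (\<lambda>i. omega_act_basis \<mu> b i f) x"


section \<open>The defining formulas on basis vectors\<close>

lemma lookup_vir_scale [simp]: "Poly_Mapping.lookup (vir_scale c x) i = c * Poly_Mapping.lookup x i"
  by (simp add: vir_scale_def Poly_Mapping.map.rep_eq when_def)

lemma vir_scale_one [simp]: "vir_scale 1 x = x"
  by (rule poly_mapping_eqI) simp

lemma vir_bracket_L_L:
  "vir_bracket (vL m) (vL n) =
     vir_scale (of_int (n - m)) (vL (n + m)) +
     (if n = - m then vir_scale ((of_int m ^ 3 - of_int m) / 12) vC else 0)"
  by (simp add: vir_bracket_def lin_ext_def)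

lemma vir_bracket_C: "vir_bracket vC (vL m) = 0"
  by (simp add: vir_bracket_def lin_ext_def)

lemma vir_d_L:
  "vir_d n a (vL i) =
     vir_scale (a powi i / of_int n)
       (vL (n * i) - (if i = 0 then vir_scale ((of_int n ^ 2 - 1) / 24) vC else 0)) - vL i"
  by (simp add: vir_d_def lin_ext_def)

lemma vir_d_C: "vir_d n a vC = vir_scale (of_int n) vC - vC"
  by (simp add: vir_d_def lin_ext_def)

lemma omega_act_L:
  "omega_act \<mu> b (vL i) (monom 1 j) =
     smult (\<mu> powi i) ([:- (of_int i * b), 1:] * [:- of_int i, 1:] ^ j)"
proof -
  have "pcompose (monom 1 j) p = p ^ j" for p :: "complex poly"
    by (induction j) (simp_all add: monom_Suc monom_0 pcompose_pCons pcompose_1 one_pCons)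
  then show ?thesis
    by (simp add: omega_act_def lin_ext_def)
qed

lemma omega_act_C: "omega_act \<mu> b vC f = 0"
  by (simp add: omega_act_def lin_ext_def)

end

theory Submission
  imports Defs
begin

text \<open>
  Adding the identity turns both defining conditions into multiplicative ones. A linear map \<open>d\<close>
  is a 1-differential operator exactly when \<open>D = d + id\<close> is a Lie algebra endomorphism, and then
  \<open>\<delta>\<close> is a 1-differential module structure exactly when \<open>\<phi> = \<delta> + id\<close> intertwines the action along
  \<open>D\<close>, that is \<open>\<phi> (x v) = D x (\<phi> v)\<close>. For the operator \<open>vir_d n a\<close> the map \<open>D\<close> sends \<open>L i\<close> to \<open>(a^i / n) L (n i)\<close>,
  corrected by a multiple of \<open>C\<close> when \<open>i = 0\<close>; the correction is invisible on \<open>\<Omega>(\<mu>, b)\<close>, where \<open>C\<close>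
  acts as zero. So the module condition becomes
  \<open>\<phi>(L i f)(t) = (a^i / n) \<mu>^(n i) (t - n i b) \<phi>(f)(t - n i)\<close>
  for all \<open>i\<close> and \<open>f\<close> (lemma \<open>one_diff_module_omega_iff\<close>).

  Since \<open>L 0\<close> acts as multiplication by \<open>t\<close>, the case \<open>i = 0\<close> reads \<open>\<phi> (t f) = (t / n) \<phi> f\<close>. Hence
  \<open>\<phi> f = f(t / n) \<xi>\<close> for the polynomial \<open>\<xi> = \<phi> 1\<close>. The case \<open>i = 1\<close>, \<open>f = 1\<close> then gives
  \<open>\<xi>(t) = a \<mu>^(n - 1) \<xi>(t - n)\<close> after cancelling a linear factor. Either \<open>\<xi> = 0\<close>, and \<open>\<delta>\<close> is the
  trivial structure, or comparing leading coefficients gives \<open>a \<mu>^(n - 1) = 1\<close>, and \<open>\<xi>\<close> is periodic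
  with nonzero period, hence constant (lemma \<open>scaled_shift_invariant_poly\<close>). Conversely, when
  \<open>a \<mu>^(n - 1) = 1\<close>, the scalars \<open>a^i \<mu>^(n i)\<close> and \<open>\<mu>^i\<close> coincide, so the intertwining identity holds
  for every constant \<open>\<xi>\<close>.

  A 1-differential module includes the structures it lives on, so the argument also needs that
  \<open>Vir\<close> satisfies the Jacobi identity, that \<open>D\<close> preserves the bracket, and that \<open>\<Omega>(\<mu>, b)\<close> is a
  module. All three are multilinear identities and are checked on basis vectors.
\<close>

section \<open>Linear extension from the basis\<close>

interpretation vir: vector_space vir_scale
  by unfold_locales (auto intro!: poly_mapping_eqI simp: lookup_add algebra_simps)

interpretation cpoly: vector_space "smult :: complex \<Rightarrow> complex poly \<Rightarrow> complex poly"
  by unfold_locales (auto simp: smult_add_left smult_add_right)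

text \<open>
  The sum in \<open>lin_ext\<close> ranges over a support that depends on the argument; on a common larger
  index set the sums for different arguments can be compared term by term.
\<close>

lemma lin_ext_superset:
  assumes "vector_space s" "finite S" "Poly_Mapping.keys x \<subseteq> S"
  shows "lin_ext s f x = (\<Sum>i\<in>S. s (Poly_Mapping.lookup x i) (f i))"
proof -
  interpret vector_space s by fact
  show ?thesis
    unfolding lin_ext_def using assms(2,3)
    by (intro sum.mono_neutral_left) (auto simp: in_keys_iff)
qed

lemma lin_ext_add:
  assumes "vector_space s"
  shows "lin_ext s f (x + y) = lin_ext s f x + lin_ext s f y"
proof -
  interpret vector_space s by fact
  let ?S = "Poly_Mapping.keys x \<union> Poly_Mapping.keys y"
  have "Poly_Mapping.keys (x + y) \<subseteq> ?S"
    by (rule Poly_Mapping.keys_add)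
  then show ?thesis
    by (simp add: lin_ext_superset[OF assms, of ?S] lookup_add scale_left_distrib sum.distrib)
qed

lemma lin_ext_scale:
  assumes "vector_space s"
  shows "lin_ext s f (vir_scale c x) = s c (lin_ext s f x)"
proof -
  interpret vector_space s by fact
  have "Poly_Mapping.keys (vir_scale c x) \<subseteq> Poly_Mapping.keys x"
    by (auto simp: in_keys_iff)
  then show ?thesis
    by (simp add: lin_ext_superset[OF assms, of "Poly_Mapping.keys x"] scale_sum_right)
qed

lemma lin_ext_basis:
  assumes "vector_space s"
  shows "lin_ext s f (Poly_Mapping.single i 1) = f i"
proof -
  interpret vector_space s by fact
  show ?thesis by (simp add: lin_ext_def)
qed

text \<open>
  The working form of ``it suffices to check on basis vectors'': identities linear in one argument
  are proved by this induction, nested once for each argument.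
\<close>

lemma vir_basis_induct [case_names basis add scale]:
  assumes "\<And>i. P (Poly_Mapping.single i 1)"
    and add: "\<And>x y. P x \<Longrightarrow> P y \<Longrightarrow> P (x + y)"
    and scale: "\<And>c x. P x \<Longrightarrow> P (vir_scale c x)"
  shows "P x"
proof (induction x rule: update_induct)
  case const
  have "vir_scale 0 vC = 0" by simp
  with assms(1) scale show ?case by metis
next
  case (update f k v)
  have "Poly_Mapping.update k v f = f + vir_scale v (Poly_Mapping.single k 1)"
    using update(1) by (intro poly_mapping_eqI)
      (auto simp: lookup_add lookup_single when_def lookup_update in_keys_iff)
  with update.IH assms(1) add scale show ?case by metis
qed


section \<open>The Virasoro Lie algebra\<close>

lemma vir_bracket_add_left: "vir_bracket (x + y) z = vir_bracket x z + vir_bracket y z"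
  and vir_bracket_scale_left: "vir_bracket (vir_scale c x) z = vir_scale c (vir_bracket x z)"
  by (simp_all add: vir_bracket_def lin_ext_add[OF vir.vector_space_axioms]
      lin_ext_scale[OF vir.vector_space_axioms])

lemma vir_bracket_add_right: "vir_bracket x (y + z) = vir_bracket x y + vir_bracket x z"
  by (simp add: vir_bracket_def lin_ext_add[OF vir.vector_space_axioms])
    (simp add: lin_ext_def vir.scale_right_distrib sum.distrib)

lemma vir_bracket_scale_right: "vir_bracket x (vir_scale c y) = vir_scale c (vir_bracket x y)"
  by (simp add: vir_bracket_def lin_ext_scale[OF vir.vector_space_axioms])
    (simp add: lin_ext_def vir.scale_sum_right mult.left_commute)

lemmas vir_bracket_bilinear = vir_bracket_add_left vir_bracket_scale_left
  vir_bracket_add_right vir_bracket_scale_right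

lemma vir_bracket_zero_right [simp]: "vir_bracket x 0 = 0"
  using vir_bracket_scale_right[of x 0 0] by simp

lemma vir_bracket_basis:
  "vir_bracket (Poly_Mapping.single i 1) (Poly_Mapping.single j 1) = vir_bracket_basis i j"
  by (simp add: vir_bracket_def lin_ext_basis[OF vir.vector_space_axioms])

lemma vir_bracket_vC: "vir_bracket vC x = 0" "vir_bracket x vC = 0"
proof -
  have *: "vir_bracket_basis C i = 0" "vir_bracket_basis i C = 0" for i
    by (cases i; simp)+
  show "vir_bracket vC x = 0"
    by (induction x rule: vir_basis_induct) (simp_all add: vir_bracket_basis * vir_bracket_bilinear)
  show "vir_bracket x vC = 0"
    by (induction x rule: vir_basis_induct) (simp_all add: vir_bracket_basis * vir_bracket_bilinear)
qed

text \<open>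
  The coefficient of \<open>C\<close> in \<open>[L i, L j]\<close>, a Lie algebra 2-cocycle on the Witt algebra. As a total
  function of \<open>i\<close> and \<open>j\<close> it removes the case distinction from the bracket formulas.
\<close>

definition vir_cocycle :: "int \<Rightarrow> int \<Rightarrow> complex" where
  "vir_cocycle i j = (if i + j = 0 then (of_int i ^ 3 - of_int i) / 12 else 0)"

lemma vir_bracket_vL:
  "vir_bracket (vL i) (vL j) =
     vir_scale (of_int (j - i)) (vL (i + j)) + vir_scale (vir_cocycle i j) vC"
  unfolding vir_bracket_L_L vir_cocycle_def
  by (simp add: add.commute eq_neg_iff_add_eq_0)

lemma vir_bracket_vL_vL_vL:
  "vir_bracket (vL i) (vir_bracket (vL j) (vL k)) =
     vir_scale (of_int ((k - j) * (j + k - i))) (vL (i + j + k)) +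
     vir_scale (of_int (k - j) * vir_cocycle i (j + k)) vC"
  by (simp add: vir_bracket_vL vir_bracket_bilinear vir_bracket_vC vir.scale_right_distrib add.assoc)

text \<open>
  Alternation is quadratic in \<open>x\<close>, so it does not reduce to basis vectors directly; its
  polarization does, and gives it back because 2 is invertible.
\<close>

lemma vir_bracket_antisym: "vir_bracket x y + vir_bracket y x = 0"
proof (induction x rule: vir_basis_induct)
  case (basis i)
  show ?case
  proof (induction y rule: vir_basis_induct)
    case (basis j)
    show ?case
    proof (cases "i = C \<or> j = C")
      case False
      then obtain m n where [simp]: "i = L m" "j = L n" by (metis vir_basis.exhaust)
      have "vir_cocycle m n + vir_cocycle n m = 0"
        by (auto simp: vir_cocycle_def field_simps eq_neg_iff_add_eq_0[symmetric])
      then show ?thesis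
        by (auto simp: vir_bracket_vL add.commute lookup_add lookup_single when_def distrib_right[symmetric]
            intro!: poly_mapping_eqI)
    qed (auto simp: vir_bracket_vC)
  next
    case (add x y) then show ?case
      by (simp add: vir_bracket_bilinear algebra_simps)
  next
    case (scale c x) then show ?case
      by (simp add: vir_bracket_bilinear vir.scale_right_distrib[symmetric])
  qed
next
  case (add x y') then show ?case
    by (simp add: vir_bracket_bilinear algebra_simps)
next
  case (scale c x) then show ?case
    by (simp add: vir_bracket_bilinear vir.scale_right_distrib[symmetric])
qed

lemma vir_bracket_self: "vir_bracket x x = 0"
proof -
  have "vir_scale 2 (vir_bracket x x) = 0"
    using vir_bracket_antisym[of x x] vir.scale_left_distrib[of 1 1 "vir_bracket x x"] by simp
  then show ?thesis by simp
qed

text \<open>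
  The cocycle identity, the part of the Jacobi identity with values in the centre. Only
  \<open>i + j + k = 0\<close> matters, where it is a polynomial identity in two integers.
\<close>

lemma vir_cocycle_jacobi:
  "of_int (k - j) * vir_cocycle i (j + k) + of_int (i - k) * vir_cocycle j (k + i) +
   of_int (j - i) * vir_cocycle k (i + j) = 0"
proof (cases "i + j + k = 0")
  case True
  then have k: "k = - i - j" by simp
  show ?thesis
    by (simp add: k vir_cocycle_def field_simps power3_eq_cube)
next
  case False
  then show ?thesis by (simp add: vir_cocycle_def algebra_simps)
qed

text \<open>
  The Jacobiator is trilinear and invariant under cyclic rotation. So linearity in the first slot
  alone allows each of the three arguments in turn to be reduced to a basis vector.
\<close>

lemma vir_jacobi:
  "vir_bracket x (vir_bracket y z) + vir_bracket y (vir_bracket z x) +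
   vir_bracket z (vir_bracket x y) = 0" (is "?J x y z = 0")
proof -
  have addJ: "?J (x + x') y z = ?J x y z + ?J x' y z" for x x' y z
    by (simp add: vir_bracket_bilinear algebra_simps)
  have scaleJ: "?J (vir_scale c x) y z = vir_scale c (?J x y z)" for c x y z
    by (simp add: vir_bracket_bilinear vir.scale_right_distrib)
  have cycJ: "?J x y z = ?J y z x" for x y z
    by (simp add: algebra_simps)
  have C: "?J vC y z = 0" for y z
    by (simp add: vir_bracket_vC)
  have LLL: "?J (vL i) (vL j) (vL k) = 0" for i j k
  proof -
    have "?J (vL i) (vL j) (vL k) =
      vir_scale (of_int ((k - j) * (j + k - i) + (i - k) * (k + i - j) + (j - i) * (i + j - k)))
        (vL (i + j + k)) +
      vir_scale (of_int (k - j) * vir_cocycle i (j + k) + of_int (i - k) * vir_cocycle j (k + i) +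
        of_int (j - i) * vir_cocycle k (i + j)) vC"
      unfolding vir_bracket_vL_vL_vL of_int_add vir.scale_left_distrib by (simp only: ac_simps)
    also have "(k - j) * (j + k - i) + (i - k) * (k + i - j) + (j - i) * (i + j - k) = 0"
      by (simp add: algebra_simps)
    finally show ?thesis by (simp only: vir_cocycle_jacobi of_int_0) simp
  qed
  have *: "?J x y z = 0"
    if "\<And>i. ?J (vL i) y z = 0" for x y z
  proof (induction x rule: vir_basis_induct)
    case (basis i)
    then show ?case using that C by (cases i) auto
  qed (simp_all only: addJ scaleJ vir.scale_zero_right add_0)
  \<comment> \<open>Rotate each argument into the first slot and reduce it to some \<open>L i\<close> there.\<close>
  show ?thesis
    by (metis * LLL cycJ)
qed

lemma lie_algebra_vir: "lie_algebra vir_scale vir_bracket"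
  by unfold_locales
    (auto simp: Vector_Spaces.linear_iff vir.vector_space_axioms
       vir_bracket_bilinear vir_bracket_self vir_jacobi)


section \<open>The operator \<open>d + id\<close> as a Lie algebra endomorphism\<close>

lemma vir_d_add: "vir_d n a (x + y) = vir_d n a x + vir_d n a y"
  and vir_d_scale: "vir_d n a (vir_scale c x) = vir_scale c (vir_d n a x)"
  by (simp_all add: vir_d_def lin_ext_add[OF vir.vector_space_axioms]
      lin_ext_scale[OF vir.vector_space_axioms])

definition vir_hom :: "int \<Rightarrow> complex \<Rightarrow> vir \<Rightarrow> vir" where
  "vir_hom n a x = vir_d n a x + x"

lemma vir_hom_add: "vir_hom n a (x + y) = vir_hom n a x + vir_hom n a y"
  and vir_hom_scale: "vir_hom n a (vir_scale c x) = vir_scale c (vir_hom n a x)"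
  by (simp_all add: vir_hom_def vir_d_add vir_d_scale vir.scale_right_distrib)

lemma vir_hom_vC: "vir_hom n a vC = vir_scale (of_int n) vC"
  by (simp add: vir_hom_def vir_d_C)

lemma vir_hom_vL:
  "vir_hom n a (vL i) = vir_scale (a powi i / of_int n) (vL (n * i)) -
     vir_scale (if i = 0 then (of_int n ^ 2 - 1) / (24 * of_int n) else 0) vC"
  by (simp add: vir_hom_def vir_d_L vir.scale_right_diff_distrib)

text \<open>
  The map \<open>L i \<mapsto> (a^i / n) L (n i)\<close> is an endomorphism of the Witt algebra, because \<open>i \<mapsto> a^i\<close> is
  multiplicative, so only the central terms need care. At the pair \<open>(i, - i)\<close>, the cocycle pulled
  back along \<open>i \<mapsto> n i\<close> and divided by \<open>n^2\<close> exceeds \<open>n\<close> times the cocycle by \<open>i (n^2 - 1) / (12 n)\<close>.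
  This is linear in \<open>i\<close>, hence a coboundary, and the correction of the image of \<open>L 0\<close> accounts for
  exactly this difference.
\<close>

lemma vir_hom_bracket:
  assumes "n \<noteq> 0" "a \<noteq> 0"
  shows "vir_hom n a (vir_bracket x y) = vir_bracket (vir_hom n a x) (vir_hom n a y)"
proof (induction x rule: vir_basis_induct)
  case (basis i)
  show ?case
  proof (induction y rule: vir_basis_induct)
    case (basis j)
    show ?case
    proof (cases "i = C \<or> j = C")
      case True
      have "vir_hom n a 0 = 0" using vir_hom_scale[of n a 0 0] by simp
      with True show ?thesis by (auto simp: vir_bracket_vC vir_hom_vC vir_bracket_bilinear)
    next
      case False
      then obtain k l where [simp]: "i = L k" "j = L l" by (metis vir_basis.exhaust)
      have minus: "vir_bracket (x - vir_scale c vC) (y - vir_scale d vC) = vir_bracket x y" for x y c d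
        using vir_bracket_add_left[of "x - vir_scale c vC" "vir_scale c vC"]
          vir_bracket_add_right[of _ "y - vir_scale d vC" "vir_scale d vC"]
        by (simp add: vir_bracket_scale_left vir_bracket_scale_right vir_bracket_vC)
      have pw: "a powi (k + l) = a powi k * a powi l"
        using assms by (simp add: power_int_add)
      \<comment> \<open>\<open>s\<close> is the central correction carried by the image of \<open>L (k + l)\<close>.\<close>
      define p q where "p = a powi k / of_int n" and "q = a powi l / of_int n"
      define s where "s = (if k + l = 0 then (of_int n ^ 2 - 1) / (24 * of_int n) else 0 :: complex)"
      have "of_int (l - k) * (a powi (k + l) / of_int n) = p * q * of_int (n * l - n * k)"
        using assms by (simp add: p_def q_def pw field_simps)
      moreover have "of_int n * vir_cocycle k l - of_int (l - k) * s = p * q * vir_cocycle (n * k) (n * l)"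
      proof (cases "k + l = 0")
        case True
        then have l: "l = - k" by simp
        have "p * q = 1 / of_int n ^ 2"
          using pw True by (simp add: p_def q_def power2_eq_square)
        then show ?thesis using assms True unfolding \<open>p * q = _\<close> l s_def
          by (simp add: vir_cocycle_def field_simps power2_eq_square power3_eq_cube)
      next
        case False
        then show ?thesis using assms by (simp add: vir_cocycle_def s_def flip: distrib_left)
      qed
      moreover have "vir_hom n a (vir_bracket (vL k) (vL l)) =
          vir_scale (of_int (l - k) * (a powi (k + l) / of_int n)) (vL (n * k + n * l)) +
          vir_scale (of_int n * vir_cocycle k l - of_int (l - k) * s) vC"
        unfolding vir_bracket_vL vir_hom_add vir_hom_scale vir_hom_vC vir_hom_vL s_def[symmetric]
        by (simp add: vir.scale_right_diff_distrib vir.scale_left_diff_distrib distrib_left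
            mult.commute del: of_int_diff)
      moreover have "vir_bracket (vir_hom n a (vL k)) (vir_hom n a (vL l)) =
          vir_scale (p * q * of_int (n * l - n * k)) (vL (n * k + n * l)) +
          vir_scale (p * q * vir_cocycle (n * k) (n * l)) vC"
        unfolding vir_hom_vL minus p_def[symmetric] q_def[symmetric] vir_bracket_scale_left
          vir_bracket_scale_right vir_bracket_vL
        by (simp add: vir.scale_right_distrib mult.assoc mult.left_commute del: of_int_diff)
      ultimately show ?thesis by simp
    qed
  qed (simp_all add: vir_bracket_bilinear vir_hom_add vir_hom_scale)
qed (simp_all add: vir_bracket_bilinear vir_hom_add vir_hom_scale)

text \<open>
  Expanding \<open>[d x + x, d y + y]\<close> shows that multiplicativity of \<open>d + id\<close> is the defining identity of
  a 1-differential operator, with \<open>[x, y]\<close> added to both sides.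
\<close>

lemma one_diff_lie_algebra_vir:
  assumes "n \<noteq> 0" "a \<noteq> 0"
  shows "one_diff_lie_algebra vir_scale vir_bracket (vir_d n a)"
proof (intro one_diff_lie_algebra.intro lie_algebra_vir one_diff_lie_algebra_axioms.intro)
  show "Vector_Spaces.linear vir_scale vir_scale (vir_d n a)"
    by (simp add: Vector_Spaces.linear_iff vir.vector_space_axioms vir_d_add vir_d_scale)
next
  fix x y
  show "vir_d n a (vir_bracket x y) =
     vir_bracket (vir_d n a x) y + vir_bracket x (vir_d n a y) +
     vir_bracket (vir_d n a x) (vir_d n a y)"
    using vir_hom_bracket[OF assms, of x y]
    by (simp add: vir_hom_def vir_bracket_bilinear algebra_simps)
qed


section \<open>The modules \<open>\<Omega>(\<mu>, b)\<close>\<close>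

lemma omega_act_basis_add:
  "omega_act_basis \<mu> b i (f + g) = omega_act_basis \<mu> b i f + omega_act_basis \<mu> b i g"
  by (cases i) (simp_all add: pcompose_add smult_add_right algebra_simps)

lemma omega_act_basis_scale:
  "omega_act_basis \<mu> b i (smult c f) = smult c (omega_act_basis \<mu> b i f)"
  by (cases i) (simp_all add: pcompose_smult mult.commute smult_add_right)

lemma omega_act_add_left: "omega_act \<mu> b (x + y) f = omega_act \<mu> b x f + omega_act \<mu> b y f"
  and omega_act_scale_left: "omega_act \<mu> b (vir_scale c x) f = smult c (omega_act \<mu> b x f)"
  by (simp_all add: omega_act_def lin_ext_add[OF cpoly.vector_space_axioms]
      lin_ext_scale[OF cpoly.vector_space_axioms])

lemma omega_act_add_right: "omega_act \<mu> b x (f + g) = omega_act \<mu> b x f + omega_act \<mu> b x g"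
  by (simp add: omega_act_def lin_ext_def omega_act_basis_add smult_add_right sum.distrib)

lemma omega_act_scale_right: "omega_act \<mu> b x (smult c f) = smult c (omega_act \<mu> b x f)"
  by (simp add: omega_act_def lin_ext_def omega_act_basis_scale cpoly.scale_sum_right mult.commute)

lemmas omega_act_bilinear = omega_act_add_left omega_act_scale_left
  omega_act_add_right omega_act_scale_right

text \<open>
  Evaluating at a point turns the action into an explicit weighted shift. Polynomials over an
  infinite field are determined by their values, so identities between composed actions become
  identities between numbers.
\<close>

lemma poly_omega_act_vL:
  "poly (omega_act \<mu> b (vL i) f) t = \<mu> powi i * ((t - of_int i * b) * poly f (t - of_int i))"
  by (simp add: omega_act_def lin_ext_basis[OF cpoly.vector_space_axioms] poly_pcompose algebra_simps)

lemma omega_act_bracket: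
  assumes "\<mu> \<noteq> 0"
  shows "omega_act \<mu> b (vir_bracket x y) f =
    omega_act \<mu> b x (omega_act \<mu> b y f) - omega_act \<mu> b y (omega_act \<mu> b x f)"
proof (induction x rule: vir_basis_induct)
  case (basis i)
  show ?case
  proof (induction y rule: vir_basis_induct)
    case (basis j)
    have zero: "omega_act \<mu> b 0 g = 0" "omega_act \<mu> b x 0 = 0" for g x
      using omega_act_scale_left[of \<mu> b 0 0 g] omega_act_scale_right[of \<mu> b x 0 0] by simp_all
    show ?case
    proof (cases "i = C \<or> j = C")
      case True
      then show ?thesis by (auto simp: vir_bracket_vC omega_act_C zero)
    next
      case False
      then obtain k l where [simp]: "i = L k" "j = L l" by (metis vir_basis.exhaust)
      have "poly (omega_act \<mu> b (vir_bracket (vL k) (vL l)) f) t =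
        poly (omega_act \<mu> b (vL k) (omega_act \<mu> b (vL l) f) -
          omega_act \<mu> b (vL l) (omega_act \<mu> b (vL k) f)) t" for t
        using assms
        by (simp add: vir_bracket_vL omega_act_bilinear omega_act_C poly_omega_act_vL power_int_add)
          (simp add: algebra_simps)
      then show ?thesis by (simp add: poly_eq_poly_eq_iff[symmetric] fun_eq_iff)
    qed
  qed (simp_all add: vir_bracket_bilinear omega_act_bilinear smult_diff_right)
qed (simp_all add: vir_bracket_bilinear omega_act_bilinear smult_diff_right)

lemma lie_module_omega:
  assumes "\<mu> \<noteq> 0"
  shows "lie_module vir_scale vir_bracket smult (omega_act \<mu> b)"
proof -
  interpret lie_algebra vir_scale vir_bracket by (rule lie_algebra_vir)
  show ?thesis
    using assms
    by unfold_locales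
     (auto simp: Vector_Spaces.linear_iff vir.vector_space_axioms cpoly.vector_space_axioms
       omega_act_bilinear omega_act_bracket)
qed


section \<open>Classification of the 1-differential structures\<close>

text \<open>
  Adding \<open>x f\<close> to both sides of the module condition makes it say that \<open>\<delta> + id\<close> intertwines \<open>x\<close> with
  \<open>vir_hom n a x\<close>. This is linear in \<open>x\<close> and holds for \<open>C\<close>, which is sent to a multiple of itself and
  acts as zero. There remains the condition on each \<open>L i\<close>, written out pointwise.
\<close>

lemma one_diff_module_omega_iff:
  assumes "n \<noteq> 0" "a \<noteq> 0" "\<mu> \<noteq> 0" "Vector_Spaces.linear smult smult \<delta>"
  shows "one_diff_module vir_scale vir_bracket (vir_d n a) smult (omega_act \<mu> b) \<delta> \<longleftrightarrow>
    (\<forall>i f t. poly (\<delta> (omega_act \<mu> b (vL i) f) + omega_act \<mu> b (vL i) f) t =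
       a powi i / of_int n * \<mu> powi (n * i) * (t - of_int (n * i) * b) *
       poly (\<delta> f + f) (t - of_int (n * i)))"
proof -
  interpret D: one_diff_lie_algebra vir_scale vir_bracket "vir_d n a"
    by (rule one_diff_lie_algebra_vir) fact+
  interpret M: lie_module vir_scale vir_bracket smult "omega_act \<mu> b"
    by (rule lie_module_omega) fact
  have lin: "\<delta> (f + g) = \<delta> f + \<delta> g" "\<delta> (smult c f) = smult c (\<delta> f)" for f g c
    using assms(4) by (simp_all add: Vector_Spaces.linear_iff cpoly.vector_space_axioms)
  \<comment> \<open>The central part of \<open>vir_hom n a (L 0)\<close> acts as zero.\<close>
  have hom_vL: "omega_act \<mu> b (vir_hom n a (vL i)) g = smult (a powi i / of_int n) (omega_act \<mu> b (vL (n * i)) g)"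
    for i g
    using omega_act_add_left[of \<mu> b "vir_hom n a (vL i)"
        "vir_scale (if i = 0 then (of_int n ^ 2 - 1) / (24 * of_int n) else 0) vC" g]
    by (simp add: vir_hom_vL omega_act_scale_left omega_act_C split del: if_split)
  let ?E = "\<lambda>x f. \<delta> (omega_act \<mu> b x f) + omega_act \<mu> b x f = omega_act \<mu> b (vir_hom n a x) (\<delta> f + f)"
  have "one_diff_module vir_scale vir_bracket (vir_d n a) smult (omega_act \<mu> b) \<delta> \<longleftrightarrow>
    (\<forall>x f. \<delta> (omega_act \<mu> b x f) = omega_act \<mu> b (vir_d n a x) f + omega_act \<mu> b x (\<delta> f) +
       omega_act \<mu> b (vir_d n a x) (\<delta> f))"
    using assms(4) by (simp add: one_diff_module_def one_diff_module_axioms_def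
        D.one_diff_lie_algebra_axioms M.lie_module_axioms)
  also have "\<dots> \<longleftrightarrow> (\<forall>x f. ?E x f)"
    by (simp add: vir_hom_def omega_act_bilinear algebra_simps)
  also have "\<dots> \<longleftrightarrow> (\<forall>i f. ?E (vL i) f)"
  proof (intro iffI allI)
    fix i f
    assume "\<forall>x f. ?E x f"
    then show "?E (vL i) f" by blast
  next
    fix x f
    assume *: "\<forall>i f. ?E (vL i) f"
    have "\<delta> 0 = 0" using lin(2)[of 0 0] by simp
    then have C: "?E vC f"
      by (simp add: omega_act_C vir_hom_vC omega_act_scale_left)
    show "?E x f"
    proof (induction x rule: vir_basis_induct)
      case (basis i)
      then show ?case using * C by (cases i) auto
    next
      case (add x y)
      then show ?case
        by (simp add: omega_act_add_left lin vir_hom_add algebra_simps)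
    next
      case (scale c x)
      then show ?case
        by (simp only: omega_act_scale_left lin vir_hom_scale smult_add_right[symmetric])
    qed
  qed
  also have "\<dots> \<longleftrightarrow> (\<forall>i f t. poly (\<delta> (omega_act \<mu> b (vL i) f) + omega_act \<mu> b (vL i) f) t =
      poly (omega_act \<mu> b (vir_hom n a (vL i)) (\<delta> f + f)) t)"
    by (simp only: poly_eq_poly_eq_iff[symmetric] fun_eq_iff)
  finally show ?thesis
    by (simp add: hom_vL poly_omega_act_vL mult.assoc)
qed

lemma linear_poly_eq_on_monom:
  assumes "Vector_Spaces.linear smult smult \<phi>" "Vector_Spaces.linear smult smult \<psi>"
    and "\<And>j. \<phi> (monom 1 j) = \<psi> (monom 1 j)"
  shows "\<phi> (f :: 'a::field poly) = (\<psi> f :: 'a poly)"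
proof -
  interpret \<phi>: Vector_Spaces.linear smult smult \<phi> by fact
  interpret \<psi>: Vector_Spaces.linear smult smult \<psi> by fact
  have f: "f = (\<Sum>i\<le>degree f. smult (coeff f i) (monom 1 i))"
    by (simp add: smult_monom poly_as_sum_of_monoms)
  show ?thesis
    by (subst (1 2) f) (simp add: \<phi>.sum \<psi>.sum \<phi>.scale \<psi>.scale assms(3))
qed

text \<open>
  A shift of the variable preserves the leading coefficient, which forces the factor to be 1. A
  periodic polynomial takes its value at 0 at infinitely many points, by characteristic 0, and is
  therefore constant.
\<close>

lemma scaled_shift_invariant_poly:
  fixes p :: "'a::field_char_0 poly"
  assumes "c \<noteq> 0" "p \<noteq> 0" and inv: "p = smult k (pcompose p [:- c, 1:])"
  shows "k = 1" "p = [:poly p 0:]"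
proof -
  have "lead_coeff p = lead_coeff (smult k (pcompose p [:- c, 1:]))"
    by (rule arg_cong[OF inv])
  also have "\<dots> = k * lead_coeff p"
    by (subst lead_coeff_smult, subst lead_coeff_comp) simp_all
  finally show "k = 1" using \<open>p \<noteq> 0\<close> by simp
  have per: "poly p (of_nat m * c) = poly p 0" for m
  proof (induction m)
    case (Suc m)
    have "poly p (of_nat (Suc m) * c) = poly p (of_nat m * c)"
      by (subst inv) (simp add: \<open>k = 1\<close> poly_pcompose algebra_simps)
    with Suc show ?case by simp
  qed simp
  show "p = [:poly p 0:]"
  proof (rule ccontr)
    let ?Z = "{x. poly (p - [:poly p 0:]) x = 0}"
    assume "p \<noteq> [:poly p 0:]"
    then have "finite ?Z"
      by (intro poly_roots_finite) auto
    moreover have "range (\<lambda>m. of_nat m * c) \<subseteq> ?Z"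
      using per by auto
    moreover have "inj (\<lambda>m. of_nat m * c)"
      using \<open>c \<noteq> 0\<close> by (auto intro!: injI)
    ultimately show False
      using finite_imageD finite_subset infinite_UNIV_nat by blast
  qed
qed

theorem theorem3p7:
  fixes n :: int and a \<mu> b :: complex
    and \<delta> :: "complex poly \<Rightarrow> complex poly"
  assumes "n \<noteq> 0" and "a \<noteq> 0" and "\<mu> \<noteq> 0"
    and "Vector_Spaces.linear smult smult \<delta>"
  shows "one_diff_module vir_scale vir_bracket (vir_d n a) smult (omega_act \<mu> b) \<delta> \<longleftrightarrow>
    \<delta> = (\<lambda>f. - f) \<or>
    (a * \<mu> powi (n - 1) = 1 \<and>
     (\<exists>\<xi>. \<forall>j. \<delta> (monom 1 j) = smult \<xi> ([:0, 1 / of_int n:] ^ j) - monom 1 j))"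
proof -
  define \<phi> where "\<phi> f = \<delta> f + f" for f
  let ?h = "\<lambda>f. pcompose f [:0, 1 / of_int n :: complex:]"
  have \<delta>: "\<delta> (f + g) = \<delta> f + \<delta> g" "\<delta> (smult c f) = smult c (\<delta> f)" for f g c
    using assms(4) by (simp_all add: Vector_Spaces.linear_iff)
  have \<phi>: "\<phi> (f + g) = \<phi> f + \<phi> g" "\<phi> (smult c f) = smult c (\<phi> f)" for f g c
    by (simp_all add: \<phi>_def \<delta> smult_add_right)
  have module_iff: "one_diff_module vir_scale vir_bracket (vir_d n a) smult (omega_act \<mu> b) \<delta> \<longleftrightarrow>
    (\<forall>i f t. poly (\<phi> (omega_act \<mu> b (vL i) f)) t =
       a powi i / of_int n * \<mu> powi (n * i) * (t - of_int (n * i) * b) *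
       poly (\<phi> f) (t - of_int (n * i)))"
    unfolding \<phi>_def by (rule one_diff_module_omega_iff) fact+
  have trivial_iff: "\<delta> = (\<lambda>f. - f) \<longleftrightarrow> (\<forall>f. \<phi> f = 0)"
    by (simp add: fun_eq_iff \<phi>_def eq_neg_iff_add_eq_0)
  have h_monom: "?h (monom 1 j) = [:0, 1 / of_int n:] ^ j" for j
    by (induction j) (simp_all add: monom_Suc monom_0 pcompose_pCons pcompose_1 one_pCons)
  have dilation_iff: "(\<forall>j. \<delta> (monom 1 j) = smult \<xi> ([:0, 1 / of_int n:] ^ j) - monom 1 j) \<longleftrightarrow>
      (\<forall>f. \<phi> f = smult \<xi> (?h f))" for \<xi>
  proof -
    have "Vector_Spaces.linear smult smult \<phi>" "Vector_Spaces.linear smult smult (\<lambda>f. smult \<xi> (?h f))"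
      by (simp_all add: Vector_Spaces.linear_iff cpoly.vector_space_axioms \<phi> pcompose_add pcompose_smult
          smult_add_right mult.commute)
    note eqI = linear_poly_eq_on_monom[OF this]
    have "(\<forall>j. \<delta> (monom 1 j) = smult \<xi> ([:0, 1 / of_int n:] ^ j) - monom 1 j) \<longleftrightarrow>
        (\<forall>j. \<phi> (monom 1 j) = smult \<xi> (?h (monom 1 j)))"
      by (simp add: \<phi>_def h_monom eq_diff_eq)
    also have "\<dots> \<longleftrightarrow> (\<forall>f. \<phi> f = smult \<xi> (?h f))"
      using eqI by blast
    finally show ?thesis .
  qed
  \<comment> \<open>Both sides of the intertwining identity carry a scalar; their ratio is the \<open>i\<close>-th power of \<open>a \<mu>^(n - 1)\<close>.\<close>
  have twist: "a powi i * \<mu> powi (n * i) = \<mu> powi i * (a * \<mu> powi (n - 1)) powi i" for i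
    using assms by (simp add: power_int_mult_distrib power_int_mult[symmetric] flip: power_int_add)
      (simp add: algebra_simps)
  show ?thesis
  proof
    assume "one_diff_module vir_scale vir_bracket (vir_d n a) smult (omega_act \<mu> b) \<delta>"
    then have E: "poly (\<phi> (omega_act \<mu> b (vL i) f)) t =
       a powi i / of_int n * \<mu> powi (n * i) * (t - of_int (n * i) * b) *
       poly (\<phi> f) (t - of_int (n * i))" for i f t
      by (simp add: module_iff)
    have act_0: "omega_act \<mu> b (vL 0) f = pCons 0 f" for f
      by (simp add: poly_eq_poly_eq_iff[symmetric] fun_eq_iff poly_omega_act_vL)
    \<comment> \<open>The case \<open>i = 0\<close>: \<open>\<phi>\<close> is semilinear over the dilation \<open>t \<mapsto> t / n\<close>, so \<open>\<phi> 1\<close> determines it.\<close>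
    have mult_t: "\<phi> (pCons 0 f) = [:0, 1 / of_int n:] * \<phi> f" for f
      using E[of 0 f] by (simp add: act_0 poly_eq_poly_eq_iff[symmetric] fun_eq_iff)
    define \<xi> where "\<xi> = \<phi> 1"
    have \<phi>_eq: "\<phi> f = ?h f * \<xi>" for f
    proof (induction f rule: pCons_induct)
      case 0
      show ?case using \<phi>(2)[of 0 0] by simp
    next
      case (pCons c f)
      have "pCons c f = smult c 1 + pCons 0 f" by (simp add: one_pCons)
      then have "\<phi> (pCons c f) = smult c \<xi> + [:0, 1 / of_int n:] * \<phi> f"
        by (simp only: \<phi> mult_t \<xi>_def)
      with pCons.IH show ?case
        by (simp add: pcompose_pCons algebra_simps)
    qed
    \<comment> \<open>The case \<open>i = 1\<close>, \<open>f = 1\<close>. The common factor \<open>t - n b\<close> vanishes at one point, so it is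
      cancelled between polynomials, not between values.\<close>
    let ?r = "a * \<mu> powi (n - 1)"
    have "[:- (of_int n * b), 1:] * \<xi> = [:- (of_int n * b), 1:] * smult ?r (pcompose \<xi> [:- of_int n, 1:])"
    proof -
      have E1: "poly (omega_act \<mu> b (vL 1) 1) (t / of_int n) * poly \<xi> t =
        (a powi 1 * \<mu> powi (n * 1)) / of_int n * (t - of_int n * b) * poly \<xi> (t - of_int n)" for t
        using E[of 1 1 t] by (simp add: \<phi>_eq poly_pcompose pcompose_1)
      have "\<mu> * ((t - of_int n * b) / of_int n * poly \<xi> t) =
        \<mu> * ((t - of_int n * b) / of_int n * (?r * poly \<xi> (t - of_int n)))" for t
        using E1[of t, unfolded twist] assms(1) by (simp add: poly_omega_act_vL field_simps)
      then have cancelled: "(t - of_int n * b) * poly \<xi> t = (t - of_int n * b) * (?r * poly \<xi> (t - of_int n))" for t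
        using assms(1,3) by simp
      have "poly ([:- (of_int n * b), 1:] * \<xi>) t =
          poly ([:- (of_int n * b), 1:] * smult ?r (pcompose \<xi> [:- of_int n, 1:])) t" for t
        using cancelled[of t] by (simp add: poly_pcompose algebra_simps)
      then show ?thesis
        by (simp add: poly_eq_poly_eq_iff[symmetric] fun_eq_iff del: poly_mult)
    qed
    then have inv: "\<xi> = smult ?r (pcompose \<xi> [:- of_int n, 1:])"
      by (subst (asm) mult_left_cancel) auto
    show "\<delta> = (\<lambda>f. - f) \<or> (?r = 1 \<and>
     (\<exists>\<xi>. \<forall>j. \<delta> (monom 1 j) = smult \<xi> ([:0, 1 / of_int n:] ^ j) - monom 1 j))"
    proof (cases "\<xi> = 0")
      case True
      then show ?thesis by (simp add: trivial_iff \<phi>_eq)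
    next
      case False
      have "?r = 1" "\<xi> = [:poly \<xi> 0:]"
        using scaled_shift_invariant_poly[OF _ False inv] assms(1) by simp_all
      moreover from this(2) obtain c where "\<xi> = [:c:]" ..
      then have "\<phi> f = smult c (?h f)" for f
        by (simp add: \<phi>_eq)
      ultimately show ?thesis unfolding dilation_iff by blast
    qed
  next
    assume "\<delta> = (\<lambda>f. - f) \<or> (a * \<mu> powi (n - 1) = 1 \<and>
     (\<exists>\<xi>. \<forall>j. \<delta> (monom 1 j) = smult \<xi> ([:0, 1 / of_int n:] ^ j) - monom 1 j))"
    then consider "\<forall>f. \<phi> f = 0" |
      \<xi> where "a * \<mu> powi (n - 1) = 1" "\<forall>f. \<phi> f = smult \<xi> (?h f)"
      unfolding trivial_iff dilation_iff by blast
    then show "one_diff_module vir_scale vir_bracket (vir_d n a) smult (omega_act \<mu> b) \<delta>"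
      unfolding module_iff
    proof cases
      case 1
      then show "\<forall>i f t. poly (\<phi> (omega_act \<mu> b (vL i) f)) t =
       a powi i / of_int n * \<mu> powi (n * i) * (t - of_int (n * i) * b) *
       poly (\<phi> f) (t - of_int (n * i))" by simp
    next
      case 2
      then have "a powi i * \<mu> powi (n * i) = \<mu> powi i" for i
        by (simp add: twist)
      then show "\<forall>i f t. poly (\<phi> (omega_act \<mu> b (vL i) f)) t =
       a powi i / of_int n * \<mu> powi (n * i) * (t - of_int (n * i) * b) *
       poly (\<phi> f) (t - of_int (n * i))"
        using assms(1) 2(2) by (auto simp: poly_pcompose poly_omega_act_vL field_simps)
    qed
  qed
qed

end
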